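(* Let $W\ge1$ and $1\le k^*\le W$ be integers, and let $A,B\in\mathbb{C}^{W\times W}$ be Hermitian positive semidefinite matrices such that: (1) (Hankel decay) there exist constants $C,\alpha>0$ with $\lambda_j(A)\le Ce^{-\alpha j}$ for all $j\ge1$; (2) (Slepian structure) there exist constants $C',c'>0$ with $\lambda_j(B)\le C'$ for $j\le k^*$ and $\sum_{j>k^*}\lambda_j(B)\le e^{-c'W}$. Then there exist constants $K,\alpha'>0$ depending only on $C,\alpha,C',c'$ such that for all integers $s\ge1$ with $sk^*+1\le W$, \[ \lambda_{sk^*+1}(A\circ B)\le Ke^{-\alpha' s}. \] In particular, for every $k$ with $k^*\le k\le W$, $\lambda_k(A\circ B)\le K\exp\!\big(-\alpha'\lfloor k/k^*\rfloor\big)$ (after possibly enlarging $K$).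
   Context: For a Hermitian matrix $M$, $\lambda_1(M)\ge\lambda_2(M)\ge\dots$ denote its eigenvalues in decreasing order. $A\circ B$ denotes the entrywise (Hadamard) product. *)

theory Defs
  imports "Jordan_Normal_Form.Jordan_Normal_Form"
begin

definition hermitian_mat :: "complex mat \<Rightarrow> bool" where
  "hermitian_mat A \<longleftrightarrow> A \<in> carrier_mat (dim_row A) (dim_row A) \<and>
     (\<forall>i < dim_row A. \<forall>j < dim_row A. A $$ (i, j) = cnj (A $$ (j, i)))"

definition psd_mat :: "complex mat \<Rightarrow> bool" where
  "psd_mat A \<longleftrightarrow> hermitian_mat A \<and>
     (\<forall>v \<in> carrier_vec (dim_row A). 0 \<le> Re (scalar_prod (conjugate v) (A *\<^sub>v v)))"

definition eigvals_list :: "complex mat \<Rightarrow> complex list" where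
  "eigvals_list A = (SOME as. char_poly A = (\<Prod>a\<leftarrow>as. [:- a, 1:]))"

text \<open>Real parts of the eigenvalues sorted in decreasing order (for Hermitian
  matrices the eigenvalues are real).\<close>
definition eig_desc :: "complex mat \<Rightarrow> real list" where
  "eig_desc A = rev (sort (map Re (eigvals_list A)))"

text \<open>lambda j A = j-th largest eigenvalue, 1-based (meaningful for 1 \<le> j \<le> dim).\<close>
definition eig_lambda :: "nat \<Rightarrow> complex mat \<Rightarrow> real" where
  "eig_lambda j A = eig_desc A ! (j - 1)"

definition hadamard :: "complex mat \<Rightarrow> complex mat \<Rightarrow> complex mat" where
  "hadamard A B = mat (dim_row A) (dim_col A) (\<lambda>(i, j). A $$ (i, j) * B $$ (i, j))"

end

theory Submission
  imports Defs "Jordan_Normal_Form.Schur_Decomposition"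
begin

text \<open>Write \<open>A = \<Sum> \<sigma>\<^sub>l u\<^sub>l u\<^sub>l\<^sup>*\<close> and \<open>B = \<Sum> \<mu>\<^sub>m v\<^sub>m v\<^sub>m\<^sup>*\<close> with orthonormal
  eigenbases and decreasing eigenvalues. The quadratic form of the Hadamard product at \<open>x\<close> is
  \<open>\<Sum> \<sigma>\<^sub>l \<mu>\<^sub>m F\<^sub>l\<^sub>m\<close>, where \<open>F\<^sub>l\<^sub>m = |\<langle>u\<^sub>l \<circ> v\<^sub>m, x\<rangle>|\<^sup>2\<close>. By Parseval, \<open>F\<^sub>l\<^sub>m\<close> sums to \<open>|x|\<^sup>2\<close> over all
  pairs and to at most \<open>|x|\<^sup>2\<close> over \<open>l\<close> for fixed \<open>m\<close>. On the common kernel of the \<open>s k\<close> functionals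
  \<open>\<langle>u\<^sub>l \<circ> v\<^sub>m, \<cdot>\<rangle>\<close> with \<open>l \<le> s\<close>, \<open>m \<le> k\<close>, the pairs with \<open>m \<le> k\<close> contribute at most
  \<open>\<sigma>\<^sub>s\<^sub>+\<^sub>1 \<mu>\<^sub>1 |x|\<^sup>2\<close> and those with \<open>m > k\<close> at most \<open>\<sigma>\<^sub>1 (\<Sum>\<^sub>m\<^sub>>\<^sub>k \<mu>\<^sub>m) |x|\<^sup>2\<close>, so the
  Courant--Fischer principle bounds the eigenvalue of index \<open>s k + 1\<close> by the sum of these two.\<close>

section \<open>Adjoints, block matrices and unitary matrices\<close>

definition adjoint_mat :: "complex mat \<Rightarrow> complex mat" where
  "adjoint_mat A = map_mat cnj (transpose_mat A)"

lemma adjoint_mat_carrier [simp]: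
  "A \<in> carrier_mat n m \<Longrightarrow> adjoint_mat A \<in> carrier_mat m n"
  by (auto simp: adjoint_mat_def)

lemma adjoint_mat_index:
  "A \<in> carrier_mat n m \<Longrightarrow> i < m \<Longrightarrow> j < n \<Longrightarrow> adjoint_mat A $$ (i, j) = cnj (A $$ (j, i))"
  by (auto simp: adjoint_mat_def)

lemma index_mult_mat_sum:
  assumes "A \<in> carrier_mat n m" "B \<in> carrier_mat m k" "i < n" "j < k"
  shows "(A * B) $$ (i, j) = (\<Sum>l<m. A $$ (i, l) * B $$ (l, j))"
  using assms by (simp add: scalar_prod_def atLeast0LessThan)

lemma adjoint_mat_mult:
  assumes "A \<in> carrier_mat n m" "B \<in> carrier_mat m k"
  shows "adjoint_mat (A * B) = adjoint_mat B * adjoint_mat A"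
  by (rule eq_matI, insert assms, auto simp: adjoint_mat_def scalar_prod_def mult.commute)

lemma adjoint_mat_adjoint_mat [simp]: "adjoint_mat (adjoint_mat A) = A"
  by (rule eq_matI) (auto simp: adjoint_mat_def)

lemma adjoint_mat_one_block:
  assumes "U \<in> carrier_mat n n"
  shows "adjoint_mat (four_block_mat (1\<^sub>m 1) (0\<^sub>m 1 n) (0\<^sub>m n 1) U) =
    four_block_mat (1\<^sub>m 1) (0\<^sub>m 1 n) (0\<^sub>m n 1) (adjoint_mat U)"
  by (rule eq_matI, insert assms, auto simp: adjoint_mat_def)

lemma mult_block_diag:
  fixes A D A' D' :: "'a :: comm_ring_1 mat"
  assumes "A \<in> carrier_mat k k" "D \<in> carrier_mat n n" "A' \<in> carrier_mat k k" "D' \<in> carrier_mat n n"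
  shows "four_block_mat A (0\<^sub>m k n) (0\<^sub>m n k) D * four_block_mat A' (0\<^sub>m k n) (0\<^sub>m n k) D' =
    four_block_mat (A * A') (0\<^sub>m k n) (0\<^sub>m n k) (D * D')"
  using assms
  by (simp add: mult_four_block_mat[of _ k k _ n _ n _ _ k _ n] mult_carrier_mat[of _ k k _ k]
      mult_carrier_mat[of _ n n _ n] left_add_zero_mat[of _ n n] right_add_zero_mat[of _ k k])

lemma hermitian_mat_iff_adjoint:
  assumes "A \<in> carrier_mat n n"
  shows "hermitian_mat A \<longleftrightarrow> adjoint_mat A = A"
proof
  assume "hermitian_mat A"
  then have "cnj (A $$ (j, i)) = A $$ (i, j)" if "i < n" "j < n" for i j
    using assms that unfolding hermitian_mat_def by (metis carrier_matD(1))
  then show "adjoint_mat A = A"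
    using assms by (intro eq_matI) (simp_all add: adjoint_mat_def)
next
  assume "adjoint_mat A = A"
  then have "A $$ (i, j) = cnj (A $$ (j, i))" if "i < n" "j < n" for i j
    using adjoint_mat_index[OF assms that] by metis
  then show "hermitian_mat A"
    using assms unfolding hermitian_mat_def by (metis carrier_matD(1))
qed

definition unitary_mat :: "nat \<Rightarrow> complex mat \<Rightarrow> bool" where
  "unitary_mat n U \<longleftrightarrow> U \<in> carrier_mat n n \<and> adjoint_mat U * U = 1\<^sub>m n \<and> U * adjoint_mat U = 1\<^sub>m n"

text \<open>For square matrices a left inverse is also a right inverse, so one of the two identities
  is enough.\<close>

lemma unitary_matI:
  assumes "U \<in> carrier_mat n n" "adjoint_mat U * U = 1\<^sub>m n"
  shows "unitary_mat n U"
  using assms mat_mult_left_right_inverse[OF adjoint_mat_carrier[OF assms(1)] assms(1)]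
  by (simp add: unitary_mat_def)

lemma unitary_mat_mult:
  assumes U: "unitary_mat n U" and V: "unitary_mat n V"
  shows "unitary_mat n (U * V)"
proof (rule unitary_matI)
  have c: "U \<in> carrier_mat n n" "V \<in> carrier_mat n n"
    "adjoint_mat U \<in> carrier_mat n n" "adjoint_mat V \<in> carrier_mat n n"
    and UU: "adjoint_mat U * U = 1\<^sub>m n" and VV: "adjoint_mat V * V = 1\<^sub>m n"
    using U V by (auto simp: unitary_mat_def)
  then show "U * V \<in> carrier_mat n n" by (simp add: mult_carrier_mat[of _ n n _ n])
  have "adjoint_mat (U * V) * (U * V) = adjoint_mat V * (adjoint_mat U * U * V)"
    unfolding adjoint_mat_mult[OF c(1,2)] using c
    by (simp add: assoc_mult_mat[of _ n n _ n _ n] mult_carrier_mat[of _ n n _ n])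
  also have "\<dots> = 1\<^sub>m n" using c UU VV by simp
  finally show "adjoint_mat (U * V) * (U * V) = 1\<^sub>m n" .
qed

lemma unitary_mat_one_block:
  assumes "unitary_mat n U"
  shows "unitary_mat (Suc n) (four_block_mat (1\<^sub>m 1) (0\<^sub>m 1 n) (0\<^sub>m n 1) U)"
proof (rule unitary_matI)
  have U: "U \<in> carrier_mat n n" "adjoint_mat U \<in> carrier_mat n n" "adjoint_mat U * U = 1\<^sub>m n"
    using assms by (auto simp: unitary_mat_def)
  show "four_block_mat (1\<^sub>m 1) (0\<^sub>m 1 n) (0\<^sub>m n 1) U \<in> carrier_mat (Suc n) (Suc n)"
    using U by auto
  show "adjoint_mat (four_block_mat (1\<^sub>m 1) (0\<^sub>m 1 n) (0\<^sub>m n 1) U) *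
    four_block_mat (1\<^sub>m 1) (0\<^sub>m 1 n) (0\<^sub>m n 1) U = 1\<^sub>m (Suc n)"
    unfolding adjoint_mat_one_block[OF U(1)]
    using mult_block_diag[OF one_carrier_mat U(2) one_carrier_mat U(1), of 1] U(3)
    by (auto intro!: eq_matI)
qed

text \<open>Complete \<open>v\<close> to a basis and orthogonalise; Gram-Schmidt keeps the first
  vector. Normalising the columns afterwards rescales \<open>v\<close>, whence the factor
  \<open>c\<close>.\<close>

lemma unitary_mat_extending_vector:
  assumes v: "v \<in> carrier_vec n" and v0: "v \<noteq> 0\<^sub>v n"
  obtains U c where "unitary_mat n U" "col U 0 = c \<cdot>\<^sub>v v"
proof -
  interpret cof_vec_space n "TYPE(complex)" .
  have n0: "0 < n"
  proof (rule ccontr)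
    assume "\<not> 0 < n"
    with v v0 show False by auto
  qed
  define b where "b = basis_completion v"
  define ws where "ws = gram_schmidt n b"
  from basis_completion[OF v v0, folded b_def]
  have dist_b: "distinct b" and indep: "\<not> lin_dep (set b)" and b: "set b \<subseteq> carrier_vec n"
    and hdb: "hd b = v" and len_b: "length b = n" by auto
  from hdb len_b n0 obtain vs where bv: "b = v # vs" by (cases b, auto)
  from gram_schmidt_result[OF b dist_b indep refl, folded ws_def]
  have ws: "set ws \<subseteq> carrier_vec n" "corthogonal ws" "length ws = n" by (auto simp: len_b)
  from gram_schmidt_hd[OF v, of vs, folded bv] have hdws: "hd ws = v" unfolding ws_def .
  \<comment> \<open>The Euclidean norm of the \<open>j\<close>-th vector, embedded in the complex
    numbers so that entries can be divided by it.\<close>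
  define r where "r j = complex_of_real (sqrt (\<Sum>i<n. (cmod (ws ! j $ i))\<^sup>2))" for j
  have dim: "dim_vec (ws ! j) = n" if "j < n" for j
    using ws that by (metis carrier_vecD nth_mem subsetD)
  have inner: "ws ! j \<bullet>c ws ! i = (\<Sum>k<n. ws ! j $ k * cnj (ws ! i $ k))" if "i < n" "j < n" for i j
    using dim that by (simp add: scalar_prod_def atLeast0LessThan)
  have rr: "r j * r j = ws ! j \<bullet>c ws ! j" if "j < n" for j
  proof -
    have "r j * r j = complex_of_real (\<Sum>i<n. (cmod (ws ! j $ i))\<^sup>2)"
      unfolding r_def of_real_mult[symmetric] by (simp add: sum_nonneg)
    then show ?thesis using that by (simp add: inner complex_norm_square del: of_real_power)
  qed
  have r0: "r j \<noteq> 0" if "j < n" for j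
    using rr[OF that] corthogonalD[OF ws(2), of j j] that ws(3) by auto
  define U where "U = mat n n (\<lambda>(i, j). ws ! j $ i / r j)"
  have U: "U \<in> carrier_mat n n" by (simp add: U_def)
  have "adjoint_mat U * U = 1\<^sub>m n"
  proof (rule eq_matI)
    fix i j assume "i < dim_row (1\<^sub>m n)" "j < dim_col (1\<^sub>m n)"
    then have i: "i < n" and j: "j < n" by auto
    have "(adjoint_mat U * U) $$ (i, j) = (\<Sum>k<n. cnj (ws ! i $ k / r i) * (ws ! j $ k / r j))"
      using i j U by (simp add: adjoint_mat_def scalar_prod_def U_def atLeast0LessThan)
    also have "\<dots> = (\<Sum>k<n. ws ! j $ k * cnj (ws ! i $ k)) / (r i * r j)"
      by (simp add: sum_divide_distrib r_def mult.commute)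
    also have "\<dots> = (1\<^sub>m n) $$ (i, j)"
      using corthogonalD[OF ws(2), of j i] rr[OF i] r0[OF i] i j ws(3)
      by (cases "i = j") (simp_all add: inner[symmetric])
    finally show "(adjoint_mat U * U) $$ (i, j) = (1\<^sub>m n) $$ (i, j)" .
  qed (use U in \<open>auto simp: adjoint_mat_def\<close>)
  then have "unitary_mat n U" using U by (rule unitary_matI[rotated])
  moreover have "ws ! 0 = v" using hdws ws(3) n0 by (metis hd_conv_nth length_0_conv less_numeral_extra(3))
  then have "col U 0 = (1 / r 0) \<cdot>\<^sub>v v"
    using n0 v by (intro eq_vecI) (auto simp: U_def)
  ultimately show thesis using that by blast
qed

section \<open>Unitary diagonalization of Hermitian matrices\<close>

text \<open>Induction on the list of roots: split off an eigenvector for the head of the list and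
  recurse on the complementary block. The diagonal follows the given order of \<open>es\<close>, so
  a sorted list can be supplied later.\<close>

theorem hermitian_mat_unitary_diagonalization:
  assumes "A \<in> carrier_mat n n" "hermitian_mat A" "char_poly A = (\<Prod>e\<leftarrow>es. [:- e, 1:])"
  shows "\<exists>U. unitary_mat n U \<and> A = U * mat_diag n ((!) es) * adjoint_mat U"
  using assms
proof (induction es arbitrary: n A)
  case Nil
  then have "n = 0" using degree_monic_char_poly[of A n] by auto
  then have "unitary_mat n (1\<^sub>m n)" "A = 1\<^sub>m n * mat_diag n ((!) []) * adjoint_mat (1\<^sub>m n)"
    using Nil by (auto simp: unitary_mat_def intro!: eq_matI simp: adjoint_mat_def)
  then show ?case by blast
next
  case (Cons e es N A)
  note A = \<open>A \<in> carrier_mat N N\<close>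
  have mon: "monic (\<Prod>e\<leftarrow>es. [:- e, 1:])" by (rule monic_prod_list) auto
  then have "(\<Prod>e\<leftarrow>es. [:- e, 1:]) \<noteq> 0" by auto
  \<comment> \<open>Comparing degrees shows that the dimension is positive, which leaves room for
    the block to be split off.\<close>
  then have "degree (char_poly A) = Suc (degree (\<Prod>e\<leftarrow>es. [:- e, 1:]))"
    unfolding Cons.prems(3) by (simp add: degree_mult_eq del: mult_pCons_left)
  with degree_monic_char_poly[OF A] obtain n where N: "N = Suc n" by (cases N) auto
  have "eigenvalue A e"
    unfolding eigenvalue_root_char_poly[OF A] Cons.prems(3) by simp
  then obtain v where v: "v \<in> carrier_vec N" "v \<noteq> 0\<^sub>v N" and Av: "A *\<^sub>v v = e \<cdot>\<^sub>v v"
    using A unfolding eigenvalue_def eigenvector_def by auto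
  obtain W c where W: "unitary_mat N W" and col: "col W 0 = c \<cdot>\<^sub>v v"
    using unitary_mat_extending_vector[OF v] .
  have WC: "W \<in> carrier_mat N N" "adjoint_mat W \<in> carrier_mat N N"
    and WW: "adjoint_mat W * W = 1\<^sub>m N" "W * adjoint_mat W = 1\<^sub>m N"
    using W by (auto simp: unitary_mat_def)
  \<comment> \<open>\<open>A\<close> in an orthonormal basis whose first vector is an eigenvector
    for \<open>e\<close>. Its first column is therefore \<open>e\<close> followed by zeros, and
    Hermitian symmetry gives the same for the first row.\<close>
  define A' where "A' = adjoint_mat W * (A * W)"
  have A': "A' \<in> carrier_mat N N"
    using A WC unfolding A'_def by (simp add: mult_carrier_mat[of _ N N _ N])
  have AW: "A = W * A' * adjoint_mat W"
  proof -
    have "W * A' * adjoint_mat W = (W * adjoint_mat W) * A * (W * adjoint_mat W)"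
      unfolding A'_def using A WC by (simp add: assoc_mult_mat[of _ N N _ N _ N] mult_carrier_mat[of _ N N _ N])
    then show ?thesis using A WW by simp
  qed
  have hA': "adjoint_mat A' = A'"
    using A WC Cons.prems(2) unfolding hermitian_mat_iff_adjoint[OF A] A'_def
    by (simp add: adjoint_mat_mult[of _ N N _ N] assoc_mult_mat[of _ N N _ N _ N] mult_carrier_mat[of _ N N _ N])
  have AW0: "(A * W) $$ (k, 0) = e * W $$ (k, 0)" if "k < N" for k
  proof -
    have "(A * W) $$ (k, 0) = c * (A *\<^sub>v v) $ k"
      using that A WC v N by (simp add: col)
    also have "\<dots> = e * (c \<cdot>\<^sub>v v) $ k" using that v by (simp add: Av)
    also have "(c \<cdot>\<^sub>v v) $ k = W $$ (k, 0)" unfolding col[symmetric] using that WC N by simp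
    finally show ?thesis .
  qed
  have sym': "A' $$ (i, j) = cnj (A' $$ (j, i))" if "i < N" "j < N" for i j
    using adjoint_mat_index[OF A' that] unfolding hA' .
  have col0: "A' $$ (i, 0) = (if i = 0 then e else 0)" if i: "i < N" for i
  proof -
    have "A' $$ (i, 0) = (\<Sum>k<N. adjoint_mat W $$ (i, k) * (A * W) $$ (k, 0))"
      unfolding A'_def using i A WC N
      by (intro index_mult_mat_sum) (auto intro: mult_carrier_mat[of _ N N _ N])
    also have "\<dots> = e * (\<Sum>k<N. adjoint_mat W $$ (i, k) * W $$ (k, 0))"
      by (simp add: AW0 sum_distrib_left mult.left_commute)
    also have "(\<Sum>k<N. adjoint_mat W $$ (i, k) * W $$ (k, 0)) = (adjoint_mat W * W) $$ (i, 0)"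
      using i WC N by (intro index_mult_mat_sum[symmetric]) auto
    finally show ?thesis using i N by (simp add: WW)
  qed
  have row0: "A' $$ (0, i) = (if i = 0 then e else 0)" if i: "i < N" for i
    using sym'[OF _ i, of 0] col0[OF i] col0[of 0] i N by (cases "i = 0") auto
  define A3 where "A3 = mat n n (\<lambda>(i, j). A' $$ (Suc i, Suc j))"
  have A3: "A3 \<in> carrier_mat n n" by (simp add: A3_def)
  let ?E = "mat 1 1 (\<lambda>_. e)"
  have blk: "A' = four_block_mat ?E (0\<^sub>m 1 n) (0\<^sub>m n 1) A3"
    by (rule eq_matI, insert A' N col0 row0, auto simp: A3_def)
  have herm: "hermitian_mat A3"
    unfolding hermitian_mat_def A3_def using N by (auto intro: sym')
  \<comment> \<open>Similarity preserves the characteristic polynomial; cancelling the factor of the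
    1 by 1 block leaves the product over \<open>es\<close> for \<open>A3\<close>, as the induction
    hypothesis needs.\<close>
  have "similar_mat A A'"
    unfolding similar_mat_def
    by (rule exI[of _ W], rule exI[of _ "adjoint_mat W"], rule similar_mat_witI[of _ _ N])
      (rule A A' WC WW AW)+
  then have "char_poly A = char_poly A'" by (rule char_poly_similar)
  also have "\<dots> = char_poly ?E * char_poly A3"
    unfolding blk by (rule char_poly_four_block_zeros_col[OF _ _ A3]) auto
  also have "char_poly ?E = [:- e, 1:]"
    by (simp add: char_poly_defs det_def sign_def)
  finally have "char_poly A3 = (\<Prod>e\<leftarrow>es. [:- e, 1:])"
    using Cons.prems(3) by (simp del: mult_pCons_left)
  from Cons.IH[OF A3 herm this] obtain V where V: "unitary_mat n V"
    and A3V: "A3 = V * mat_diag n ((!) es) * adjoint_mat V" by blast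
  have VC: "V \<in> carrier_mat n n" "adjoint_mat V \<in> carrier_mat n n"
    using V by (auto simp: unitary_mat_def)
  \<comment> \<open>Extends \<open>V\<close> by the identity on the eigenvector already split off;
    \<open>W * V'\<close> then diagonalises \<open>A\<close>.\<close>
  define V' where "V' = four_block_mat (1\<^sub>m 1) (0\<^sub>m 1 n) (0\<^sub>m n 1) V"
  have V': "unitary_mat N V'" unfolding V'_def N using V by (rule unitary_mat_one_block)
  have V'C: "V' \<in> carrier_mat N N" "adjoint_mat V' \<in> carrier_mat N N"
    using V' by (auto simp: unitary_mat_def)
  have D: "mat_diag N ((!) (e # es)) = four_block_mat ?E (0\<^sub>m 1 n) (0\<^sub>m n 1) (mat_diag n ((!) es))"
    by (rule eq_matI) (auto simp: N mat_diag_def nth_Cons')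
  have adV: "adjoint_mat V' = four_block_mat (1\<^sub>m 1) (0\<^sub>m 1 n) (0\<^sub>m n 1) (adjoint_mat V)"
    unfolding V'_def using VC(1) by (rule adjoint_mat_one_block)
  have VD: "V' * mat_diag N ((!) (e # es)) =
    four_block_mat ?E (0\<^sub>m 1 n) (0\<^sub>m n 1) (V * mat_diag n ((!) es))"
    unfolding V'_def D using mult_block_diag[OF one_carrier_mat VC(1), of ?E 1 "mat_diag n ((!) es)"] by simp
  have "A' = V' * mat_diag N ((!) (e # es)) * adjoint_mat V'"
    unfolding VD adV blk A3V
    using mult_block_diag[of ?E 1 "V * mat_diag n ((!) es)" n "1\<^sub>m 1" "adjoint_mat V"] VC
    by (simp add: mult_carrier_mat[of _ n n _ n])
  then have "A = (W * V') * mat_diag N ((!) (e # es)) * adjoint_mat (W * V')"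
    using WC V'C
    by (subst AW) (simp add: adjoint_mat_mult[of _ N N _ N] assoc_mult_mat[of _ N N _ N _ N] mult_carrier_mat[of _ N N _ N])
  with unitary_mat_mult[OF W V'] show ?case by blast
qed

section \<open>Ordered real eigenvalues and the spectral decomposition\<close>

lemma hermitian_matD:
  assumes "A \<in> carrier_mat n n" "hermitian_mat A" "i < n" "j < n"
  shows "A $$ (i, j) = cnj (A $$ (j, i))"
  using assms unfolding hermitian_mat_def by (metis carrier_matD(1))

lemma length_linear_factors:
  assumes "A \<in> carrier_mat n n" "char_poly A = (\<Prod>a\<leftarrow>as. [:- a, 1:])"
  shows "length as = n"
  using degree_linear_factors[of uminus as] degree_monic_char_poly[OF assms(1)] assms(2) by simp

text \<open>Characteristic polynomials split over the complex numbers, so the choice in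
  \<open>eigvals_list\<close> has a witness.\<close>

lemma char_poly_eigvals_list:
  assumes "A \<in> carrier_mat n n"
  shows "char_poly A = (\<Prod>a\<leftarrow>eigvals_list A. [:- a, 1:])"
  using char_poly_factorized[OF assms] unfolding eigvals_list_def by (metis (mono_tags, lifting) someI_ex)

lemma length_eig_desc: "A \<in> carrier_mat n n \<Longrightarrow> length (eig_desc A) = n"
  using length_linear_factors[OF _ char_poly_eigvals_list] by (simp add: eig_desc_def)

lemma eig_lambda_antimono:
  assumes "A \<in> carrier_mat n n" "l \<le> m" "m < n"
  shows "eig_lambda (Suc m) A \<le> eig_lambda (Suc l) A"
  unfolding eig_lambda_def
  by (rule sorted_rev_nth_mono) (use assms length_eig_desc[OF assms(1)] in \<open>auto simp: eig_desc_def\<close>)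

text \<open>The diagonal matrix \<open>adjoint_mat U * A * U\<close> is again Hermitian, so its
  diagonal entries equal their conjugates.\<close>

lemma hermitian_eigvals_real:
  assumes A: "A \<in> carrier_mat n n" "hermitian_mat A" and a: "a \<in> set (eigvals_list A)"
  shows "a \<in> \<real>"
proof -
  note cp = char_poly_eigvals_list[OF A(1)]
  obtain U where U: "unitary_mat n U"
    and AU: "A = U * mat_diag n ((!) (eigvals_list A)) * adjoint_mat U"
    using hermitian_mat_unitary_diagonalization[OF A cp] by blast
  let ?D = "mat_diag n ((!) (eigvals_list A))"
  have UC: "U \<in> carrier_mat n n" "adjoint_mat U \<in> carrier_mat n n"
    and UU: "adjoint_mat U * U = 1\<^sub>m n"
    using U by (auto simp: unitary_mat_def)
  have "adjoint_mat U * A * U = (adjoint_mat U * U) * ?D * (adjoint_mat U * U)"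
    by (subst AU) (use UC in \<open>simp add: assoc_mult_mat[of _ n n _ n _ n] mult_carrier_mat[of _ n n _ n]\<close>)
  then have D: "adjoint_mat U * A * U = ?D"
    by (simp add: UU left_mult_one_mat[of _ n n] right_mult_one_mat[of _ n n])
  have "adjoint_mat (adjoint_mat U * A * U) = adjoint_mat U * A * U"
    using A UC hermitian_mat_iff_adjoint[OF A(1)]
    by (simp add: adjoint_mat_mult[of _ n n _ n] assoc_mult_mat[of _ n n _ n _ n]
        mult_carrier_mat[of _ n n _ n])
  then have adD: "adjoint_mat ?D = ?D" unfolding D .
  obtain l where l: "l < n" "a = eigvals_list A ! l"
    using a length_linear_factors[OF A(1) cp] by (metis in_set_conv_nth)
  have "cnj (?D $$ (l, l)) = ?D $$ (l, l)"
    using adjoint_mat_index[OF mat_diag_dim l(1) l(1)] adD by metis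
  then show ?thesis using l by (simp add: mat_diag_def Reals_cnj_iff)
qed

text \<open>As the eigenvalues are real, taking real parts loses nothing, and sorting and reversing
  only permute the factors. This lets the diagonalization be run with the decreasing order.\<close>

lemma hermitian_char_poly_eig_desc:
  assumes A: "A \<in> carrier_mat n n" "hermitian_mat A"
  shows "char_poly A = (\<Prod>e\<leftarrow>map complex_of_real (eig_desc A). [:- e, 1:])"
proof -
  have "map complex_of_real (map Re (eigvals_list A)) = eigvals_list A"
    using hermitian_eigvals_real[OF A] by (simp add: list.map_comp o_def of_real_Re map_idI)
  moreover have "mset (map complex_of_real (eig_desc A)) =
      mset (map complex_of_real (map Re (eigvals_list A)))"
    unfolding eig_desc_def by (simp del: map_map)
  ultimately have m: "mset (map complex_of_real (eig_desc A)) = mset (eigvals_list A)" by simp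
  have "(\<Prod>e\<leftarrow>map complex_of_real (eig_desc A). [:- e, 1:]) =
      prod_mset (image_mset (\<lambda>e. [:- e, 1:]) (mset (map complex_of_real (eig_desc A))))"
    unfolding mset_map[symmetric] prod_mset_prod_list ..
  also have "\<dots> = (\<Prod>e\<leftarrow>eigvals_list A. [:- e, 1:])"
    unfolding m unfolding mset_map[symmetric] prod_mset_prod_list ..
  finally show ?thesis using char_poly_eigvals_list[OF A(1)] by simp
qed

text \<open>\<open>u l i\<close> is coordinate \<open>i\<close> of the \<open>l\<close>-th vector.
  The first condition is completeness, the second orthonormality; both are stored because both are
  used directly.\<close>

definition orthonormal_basis_family :: "nat \<Rightarrow> (nat \<Rightarrow> nat \<Rightarrow> complex) \<Rightarrow> bool" where
  "orthonormal_basis_family n u \<longleftrightarrow>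
    (\<forall>i<n. \<forall>j<n. (\<Sum>l<n. u l i * cnj (u l j)) = (if i = j then 1 else 0)) \<and>
    (\<forall>l<n. \<forall>m<n. (\<Sum>i<n. cnj (u l i) * u m i) = (if l = m then 1 else 0))"

theorem hermitian_spectral_decomposition:
  assumes A: "A \<in> carrier_mat n n" "hermitian_mat A"
  obtains u where "orthonormal_basis_family n u"
    "\<And>i j. i < n \<Longrightarrow> j < n \<Longrightarrow>
      A $$ (i, j) = (\<Sum>l<n. complex_of_real (eig_lambda (Suc l) A) * u l i * cnj (u l j))"
proof -
  let ?es = "map complex_of_real (eig_desc A)"
  obtain U where U: "unitary_mat n U"
    and AU: "A = U * mat_diag n ((!) ?es) * adjoint_mat U"
    using hermitian_mat_unitary_diagonalization[OF A hermitian_char_poly_eig_desc[OF A]] by blast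
  have UC: "U \<in> carrier_mat n n" "adjoint_mat U \<in> carrier_mat n n"
    and UU: "adjoint_mat U * U = 1\<^sub>m n" "U * adjoint_mat U = 1\<^sub>m n"
    using U by (auto simp: unitary_mat_def)
  define u where "u l i = U $$ (i, l)" for l i
  have ad: "adjoint_mat U $$ (l, i) = cnj (u l i)" if "l < n" "i < n" for l i
    using adjoint_mat_index[OF UC(1) that] by (simp add: u_def)
  have "(\<Sum>l<n. u l i * cnj (u l j)) = (if i = j then 1 else 0)" if "i < n" "j < n" for i j
    using index_mult_mat_sum[OF UC that] that by (simp add: ad UU u_def[symmetric])
  moreover have "(\<Sum>i<n. cnj (u l i) * u m i) = (if l = m then 1 else 0)" if "l < n" "m < n" for l m
    using index_mult_mat_sum[OF UC(2,1) that] that by (simp add: ad UU u_def[symmetric])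
  ultimately have "orthonormal_basis_family n u"
    by (simp add: orthonormal_basis_family_def)
  moreover have "A $$ (i, j) = (\<Sum>l<n. complex_of_real (eig_lambda (Suc l) A) * u l i * cnj (u l j))"
    if ij: "i < n" "j < n" for i j
  proof -
    have UD: "U * mat_diag n ((!) ?es) = mat n n (\<lambda>(i, j). U $$ (i, j) * ?es ! j)"
      using UC(1) by (rule mat_diag_mult_right)
    have "A $$ (i, j) = (\<Sum>l<n. (U * mat_diag n ((!) ?es)) $$ (i, l) * adjoint_mat U $$ (l, j))"
      using AU index_mult_mat_sum[OF _ UC(2) ij, of "U * mat_diag n ((!) ?es)"] UC
      by (simp add: UD)
    also have "\<dots> = (\<Sum>l<n. complex_of_real (eig_lambda (Suc l) A) * u l i * cnj (u l j))"
      unfolding UD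
      by (rule sum.cong) (use ij length_eig_desc[OF A(1)] in \<open>auto simp: ad u_def eig_lambda_def\<close>)
    finally show ?thesis .
  qed
  ultimately show thesis using that by blast
qed

section \<open>Quadratic forms, Parseval and nonnegative eigenvalues\<close>

text \<open>Each rank-one term contributes the squared modulus of an inner product. The index set is
  arbitrary so that it can also consist of pairs, as for the Hadamard product.\<close>

lemma quadratic_form_sum_rank_one:
  fixes x :: "nat \<Rightarrow> complex" and c :: "'l \<Rightarrow> real"
  assumes "\<And>i j. i < n \<Longrightarrow> j < n \<Longrightarrow> M i j = (\<Sum>l\<in>L. complex_of_real (c l) * u l i * cnj (u l j))"
  shows "(\<Sum>i<n. \<Sum>j<n. cnj (x i) * M i j * x j) =
    complex_of_real (\<Sum>l\<in>L. c l * (cmod (\<Sum>i<n. cnj (u l i) * x i))\<^sup>2)"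
proof -
  have sq: "complex_of_real ((cmod (\<Sum>i<n. cnj (u l i) * x i))\<^sup>2) =
      (\<Sum>i<n. \<Sum>j<n. (cnj (x i) * u l i) * (cnj (u l j) * x j))" for l
  proof -
    have "complex_of_real ((cmod (\<Sum>i<n. cnj (u l i) * x i))\<^sup>2) =
        cnj (\<Sum>i<n. cnj (u l i) * x i) * (\<Sum>i<n. cnj (u l i) * x i)"
      unfolding complex_norm_square by (rule mult.commute)
    also have "\<dots> = (\<Sum>i<n. \<Sum>j<n. cnj (cnj (u l i) * x i) * (cnj (u l j) * x j))"
      unfolding cnj_sum sum_product ..
    finally show ?thesis by (simp add: mult.commute)
  qed
  have "(\<Sum>i<n. \<Sum>j<n. cnj (x i) * M i j * x j) =
      (\<Sum>i<n. \<Sum>j<n. \<Sum>l\<in>L. complex_of_real (c l) * ((cnj (x i) * u l i) * (cnj (u l j) * x j)))"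
    by (intro sum.cong refl) (simp add: assms sum_distrib_left sum_distrib_right mult_ac)
  also have "\<dots> = (\<Sum>i<n. \<Sum>l\<in>L. \<Sum>j<n. complex_of_real (c l) * ((cnj (x i) * u l i) * (cnj (u l j) * x j)))"
    by (intro sum.cong refl) (rule sum.swap)
  also have "\<dots> = (\<Sum>l\<in>L. \<Sum>i<n. \<Sum>j<n. complex_of_real (c l) * ((cnj (x i) * u l i) * (cnj (u l j) * x j)))"
    by (rule sum.swap)
  also have "\<dots> = (\<Sum>l\<in>L. complex_of_real (c l) * complex_of_real ((cmod (\<Sum>i<n. cnj (u l i) * x i))\<^sup>2))"
    unfolding sq by (simp add: sum_distrib_left)
  finally show ?thesis by simp
qed

text \<open>Completeness writes the identity matrix as a sum of rank-one terms with all weights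
  1.\<close>

lemma parseval:
  assumes "orthonormal_basis_family n u"
  shows "(\<Sum>l<n. (cmod (\<Sum>i<n. cnj (u l i) * x i))\<^sup>2) = (\<Sum>i<n. (cmod (x i))\<^sup>2)"
proof -
  have "complex_of_real (\<Sum>l<n. (cmod (\<Sum>i<n. cnj (u l i) * x i))\<^sup>2) =
      (\<Sum>i<n. \<Sum>j<n. cnj (x i) * (if i = j then 1 else 0) * x j)"
    using assms
    by (subst quadratic_form_sum_rank_one[where L = "{..<n}" and c = "\<lambda>_. 1" and u = u])
      (auto simp: orthonormal_basis_family_def)
  also have "\<dots> = (\<Sum>i<n. cnj (x i) * x i)"
    by (intro sum.cong refl) (simp add: if_distrib[of "\<lambda>t. _ * t"] if_distrib[of "\<lambda>t. t * _"] cong: if_cong)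
  also have "\<dots> = complex_of_real (\<Sum>i<n. (cmod (x i))\<^sup>2)"
    by (simp add: complex_norm_square mult.commute del: of_real_power)
  finally show ?thesis unfolding of_real_eq_iff .
qed

lemma orthonormal_basis_family_sum_entries:
  assumes "orthonormal_basis_family n u" "i < n"
  shows "(\<Sum>l<n. (cmod (u l i))\<^sup>2) = 1"
proof -
  have "complex_of_real (\<Sum>l<n. (cmod (u l i))\<^sup>2) = 1"
    using assms by (simp add: complex_norm_square orthonormal_basis_family_def del: of_real_power)
  then show ?thesis using of_real_eq_1_iff by blast
qed

lemma orthonormal_basis_family_entry_le_1:
  assumes "orthonormal_basis_family n u" "l < n" "i < n"
  shows "(cmod (u l i))\<^sup>2 \<le> 1"
  using member_le_sum[of l "{..<n}" "\<lambda>l. (cmod (u l i))\<^sup>2"]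
    orthonormal_basis_family_sum_entries[OF assms(1,3)] assms(2) by auto

lemma psd_mat_eig_lambda_nonneg:
  assumes A: "A \<in> carrier_mat n n" "psd_mat A" and l: "l < n"
  shows "0 \<le> eig_lambda (Suc l) A"
proof -
  have "hermitian_mat A" using A by (simp add: psd_mat_def)
  from hermitian_spectral_decomposition[OF A(1) this] obtain u
    where u: "orthonormal_basis_family n u"
    and Au: "\<And>i j. i < n \<Longrightarrow> j < n \<Longrightarrow>
      A $$ (i, j) = (\<Sum>l<n. complex_of_real (eig_lambda (Suc l) A) * u l i * cnj (u l j))" by blast
  \<comment> \<open>Testing positivity on the \<open>l\<close>-th eigenvector isolates the
    \<open>l\<close>-th eigenvalue by orthonormality.\<close>
  let ?v = "vec n (u l)"
  have "scalar_prod (conjugate ?v) (A *\<^sub>v ?v) = (\<Sum>i<n. \<Sum>j<n. cnj (u l i) * A $$ (i, j) * u l j)"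
    using A(1) by (simp add: scalar_prod_def atLeast0LessThan sum_distrib_left mult.assoc)
  also have "\<dots> = complex_of_real (\<Sum>m<n. eig_lambda (Suc m) A * (cmod (\<Sum>i<n. cnj (u m i) * u l i))\<^sup>2)"
    by (rule quadratic_form_sum_rank_one) (rule Au)
  also have "(\<Sum>m<n. eig_lambda (Suc m) A * (cmod (\<Sum>i<n. cnj (u m i) * u l i))\<^sup>2) =
      (\<Sum>m<n. if m = l then eig_lambda (Suc l) A else 0)"
    using u l by (intro sum.cong) (auto simp: orthonormal_basis_family_def)
  finally have "scalar_prod (conjugate ?v) (A *\<^sub>v ?v) = complex_of_real (eig_lambda (Suc l) A)"
    using l by simp
  moreover have "0 \<le> Re (scalar_prod (conjugate ?v) (A *\<^sub>v ?v))"
    using A unfolding psd_mat_def by auto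
  ultimately show ?thesis by simp
qed

section \<open>An upper bound of Courant-Fischer type\<close>

lemma underdetermined_system_solution:
  fixes g :: "nat \<Rightarrow> nat \<Rightarrow> 'a :: field"
  obtains c l where "l \<le> r" "c l \<noteq> 0" "\<And>k. k < r \<Longrightarrow> (\<Sum>l\<le>r. g k l * c l) = 0"
proof -
  \<comment> \<open>The \<open>r\<close> equations in \<open>r + 1\<close> unknowns are padded with
    a zero row, giving a square matrix of determinant 0 and hence a nonzero kernel vector.\<close>
  define G where "G = mat\<^sub>r (Suc r) (Suc r) (\<lambda>k. if k = r then 0\<^sub>v (Suc r) else vec (Suc r) (g k))"
  have G: "G \<in> carrier_mat (Suc r) (Suc r)" by (simp add: G_def)
  have "det G = 0" unfolding G_def by (rule det_row_0) auto
  then obtain v where v: "v \<in> carrier_vec (Suc r)" "v \<noteq> 0\<^sub>v (Suc r)" "G *\<^sub>v v = 0\<^sub>v (Suc r)"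
    using det_0_iff_vec_prod_zero_field[OF G] by blast
  have "\<exists>l<Suc r. v $ l \<noteq> 0"
  proof (rule ccontr)
    assume "\<not> (\<exists>l<Suc r. v $ l \<noteq> 0)"
    with v(1) have "v = 0\<^sub>v (Suc r)" by (intro eq_vecI) auto
    with v(2) show False by simp
  qed
  then obtain l where l: "l < Suc r" "v $ l \<noteq> 0" by blast
  have "(\<Sum>l\<le>r. g k l * v $ l) = 0" if k: "k < r" for k
  proof -
    have "0 = (G *\<^sub>v v) $ k" using v(3) k by simp
    also have "\<dots> = (\<Sum>l<Suc r. g k l * v $ l)"
      using k v(1) by (simp add: G_def scalar_prod_def atLeast0LessThan)
    finally show ?thesis by (simp only: lessThan_Suc_atMost)
  qed
  with l show thesis using that[of l "\<lambda>l. v $ l"] by simp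
qed

text \<open>The half of the Courant--Fischer principle that bounds an eigenvalue from above: the span
  of the first \<open>r + 1\<close> eigenvectors meets the common kernel of any \<open>r\<close> linear functionals.\<close>

lemma eig_lambda_le_of_quadratic_form_le:
  assumes A: "A \<in> carrier_mat n n" "hermitian_mat A" and r: "r < n"
    and le: "\<And>x. (\<And>k. k < r \<Longrightarrow> (\<Sum>i<n. f k i * x i) = 0) \<Longrightarrow>
      Re (\<Sum>i<n. \<Sum>j<n. cnj (x i) * A $$ (i, j) * x j) \<le> c * (\<Sum>i<n. (cmod (x i))\<^sup>2)"
  shows "eig_lambda (Suc r) A \<le> c"
proof -
  obtain u where u: "orthonormal_basis_family n u"
    and Au: "\<And>i j. i < n \<Longrightarrow> j < n \<Longrightarrow>
      A $$ (i, j) = (\<Sum>l<n. complex_of_real (eig_lambda (Suc l) A) * u l i * cnj (u l j))"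
    using hermitian_spectral_decomposition[OF A] by blast
  \<comment> \<open>\<open>d\<close> holds the coefficients of a nonzero combination of the top
    \<open>r + 1\<close> eigenvectors that all \<open>r\<close> functionals annihilate.\<close>
  obtain d l0 where l0: "l0 \<le> r" "d l0 \<noteq> 0"
    and d: "\<And>k. k < r \<Longrightarrow> (\<Sum>l\<le>r. (\<Sum>i<n. f k i * u l i) * d l) = 0"
    using underdetermined_system_solution[of r "\<lambda>k l. \<Sum>i<n. f k i * u l i"] by blast
  define x where "x i = (\<Sum>l\<le>r. d l * u l i)" for i
  have fx: "(\<Sum>i<n. f k i * x i) = 0" if "k < r" for k
  proof -
    have "(\<Sum>i<n. f k i * x i) = (\<Sum>i<n. \<Sum>l\<le>r. f k i * u l i * d l)"
      by (simp add: x_def sum_distrib_left mult_ac)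
    also have "\<dots> = (\<Sum>l\<le>r. (\<Sum>i<n. f k i * u l i) * d l)"
      by (subst sum.swap) (simp add: sum_distrib_right)
    finally show ?thesis using d[OF that] by simp
  qed
  have ux: "(\<Sum>i<n. cnj (u m i) * x i) = (if m \<le> r then d m else 0)" if m: "m < n" for m
  proof -
    have "(\<Sum>i<n. cnj (u m i) * x i) = (\<Sum>i<n. \<Sum>l\<le>r. d l * (cnj (u m i) * u l i))"
      by (simp add: x_def sum_distrib_left mult_ac)
    also have "\<dots> = (\<Sum>l\<le>r. d l * (\<Sum>i<n. cnj (u m i) * u l i))"
      by (subst sum.swap) (simp add: sum_distrib_left)
    also have "\<dots> = (\<Sum>l\<le>r. if m = l then d m else 0)"
      using u m r by (intro sum.cong) (auto simp: orthonormal_basis_family_def)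
    finally show ?thesis by simp
  qed
  define S where "S = (\<Sum>m<n. (cmod (\<Sum>i<n. cnj (u m i) * x i))\<^sup>2)"
  have S: "(\<Sum>i<n. (cmod (x i))\<^sup>2) = S" unfolding S_def using parseval[OF u] by simp
  have "0 < S" unfolding S_def
    by (rule sum_pos2[of _ l0]) (use l0 r in \<open>auto simp: ux\<close>)
  have "eig_lambda (Suc r) A * S =
      (\<Sum>m<n. eig_lambda (Suc r) A * (cmod (\<Sum>i<n. cnj (u m i) * x i))\<^sup>2)"
    by (simp add: S_def sum_distrib_left)
  \<comment> \<open>For \<open>m \<le> r\<close> the eigenvalues are ordered; for
    \<open>m > r\<close> the coefficient of \<open>x\<close> vanishes.\<close>
  also have "\<dots> \<le> (\<Sum>m<n. eig_lambda (Suc m) A * (cmod (\<Sum>i<n. cnj (u m i) * x i))\<^sup>2)"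
    by (rule sum_mono) (use r eig_lambda_antimono[OF A(1)] in \<open>auto simp: ux intro!: mult_right_mono\<close>)
  also have "\<dots> = Re (\<Sum>i<n. \<Sum>j<n. cnj (x i) * A $$ (i, j) * x j)"
    by (subst quadratic_form_sum_rank_one[where L = "{..<n}" and u = u, OF Au]) auto
  also have "\<dots> \<le> c * S" using le[OF fx] unfolding S .
  finally show ?thesis using \<open>0 < S\<close> by simp
qed

section \<open>Eigenvalues of Hadamard products\<close>

lemma hadamard_carrier:
  "A \<in> carrier_mat n m \<Longrightarrow> hadamard A B \<in> carrier_mat n m"
  by (auto simp: hadamard_def)

lemma hermitian_hadamard:
  assumes "A \<in> carrier_mat n n" "B \<in> carrier_mat n n" "hermitian_mat A" "hermitian_mat B"
  shows "hermitian_mat (hadamard A B)"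
proof -
  have "A $$ (i, j) * B $$ (i, j) = cnj (A $$ (j, i) * B $$ (j, i))" if "i < n" "j < n" for i j
    unfolding complex_cnj_mult
    using hermitian_matD[OF assms(1,3) that] hermitian_matD[OF assms(2,4) that] by metis
  then show ?thesis using assms(1) unfolding hermitian_mat_def hadamard_def by auto
qed

text \<open>The index is one more than the number \<open>s * k\<close> of linear conditions imposed.
  The first summand pays for pairs with \<open>m < k\<close> and \<open>l \<ge> s\<close>, the
  second for those with \<open>m \<ge> k\<close>, counting from zero. The case \<open>s = 0\<close>
  is included.\<close>

theorem eig_lambda_hadamard_le:
  assumes A: "A \<in> carrier_mat n n" "psd_mat A" and B: "B \<in> carrier_mat n n" "psd_mat B"
    and k: "1 \<le> k" "s * k < n"
  shows "eig_lambda (s * k + 1) (hadamard A B) \<le>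
    eig_lambda (s + 1) A * eig_lambda 1 B + eig_lambda 1 A * (\<Sum>j\<in>{k<..n}. eig_lambda j B)"
    (is "_ \<le> ?a * ?b + ?a1 * ?t")
proof -
  have herm: "hermitian_mat A" "hermitian_mat B" using A B by (auto simp: psd_mat_def)
  have n0: "0 < n" using k by simp
  have "s \<le> s * k" using k by simp
  then have s: "s < n" using k by linarith
  obtain u where u: "orthonormal_basis_family n u"
    and Au: "\<And>i j. i < n \<Longrightarrow> j < n \<Longrightarrow>
      A $$ (i, j) = (\<Sum>l<n. complex_of_real (eig_lambda (Suc l) A) * u l i * cnj (u l j))"
    using hermitian_spectral_decomposition[OF A(1) herm(1)] by blast
  obtain v where v: "orthonormal_basis_family n v"
    and Bv: "\<And>i j. i < n \<Longrightarrow> j < n \<Longrightarrow>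
      B $$ (i, j) = (\<Sum>l<n. complex_of_real (eig_lambda (Suc l) B) * v l i * cnj (v l j))"
    using hermitian_spectral_decomposition[OF B(1) herm(2)] by blast
  define \<sigma> where "\<sigma> l = eig_lambda (Suc l) A" for l
  define \<mu> where "\<mu> m = eig_lambda (Suc m) B" for m
  have \<sigma>0: "0 \<le> \<sigma> l" if "l < n" for l
    unfolding \<sigma>_def using psd_mat_eig_lambda_nonneg[OF A that] .
  have \<mu>0: "0 \<le> \<mu> l" if "l < n" for l
    unfolding \<mu>_def using psd_mat_eig_lambda_nonneg[OF B that] .
  have \<sigma>_anti: "\<sigma> m \<le> \<sigma> l" if "l \<le> m" "m < n" for l m
    unfolding \<sigma>_def using eig_lambda_antimono[OF A(1) that] .
  have \<mu>_anti: "\<mu> m \<le> \<mu> l" if "l \<le> m" "m < n" for l m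
    unfolding \<mu>_def using eig_lambda_antimono[OF B(1) that] .
  \<comment> \<open>\<open>w (l, m)\<close> is the entrywise product of \<open>u l\<close> and
    \<open>v m\<close>. Multiplying the two spectral decompositions entrywise gives a rank-one
    decomposition of the Hadamard product, not orthogonal in general.\<close>
  define w where "w = (\<lambda>(l, m) i. u l i * v m i)"
  have H: "hadamard A B $$ (i, j) =
      (\<Sum>p\<in>{..<n} \<times> {..<n}. complex_of_real (\<sigma> (fst p) * \<mu> (snd p)) * w p i * cnj (w p j))"
    if "i < n" "j < n" for i j
  proof -
    have "hadamard A B $$ (i, j) = A $$ (i, j) * B $$ (i, j)"
      using A B that by (simp add: hadamard_def)
    also have "\<dots> = (\<Sum>l<n. \<Sum>m<n. (complex_of_real (\<sigma> l) * u l i * cnj (u l j)) *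
        (complex_of_real (\<mu> m) * v m i * cnj (v m j)))"
      unfolding Au[OF that] Bv[OF that] sum_product \<sigma>_def \<mu>_def ..
    also have "\<dots> = (\<Sum>p\<in>{..<n} \<times> {..<n}. complex_of_real (\<sigma> (fst p) * \<mu> (snd p)) * w p i * cnj (w p j))"
      unfolding sum.cartesian_product by (intro sum.cong refl) (auto simp: w_def)
    finally show ?thesis .
  qed
  have \<open>eig_lambda (Suc (s * k)) (hadamard A B) \<le> \<sigma> s * \<mu> 0 + \<sigma> 0 * (\<Sum>m\<in>{k..<n}. \<mu> m)\<close>
  \<comment> \<open>Division with remainder by \<open>k\<close> enumerates the pairs with
    \<open>l < s\<close> and \<open>m < k\<close> by a single index
    \<open>p < s * k\<close>.\<close>
  proof (rule eig_lambda_le_of_quadratic_form_le[where f = "\<lambda>p i. cnj (w (p div k, p mod k) i)"])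
    show "hadamard A B \<in> carrier_mat n n" using A(1) by (rule hadamard_carrier)
    show "hermitian_mat (hadamard A B)" using A B herm by (intro hermitian_hadamard) auto
    show "s * k < n" by fact
    fix x assume x: "\<And>p. p < s * k \<Longrightarrow> (\<Sum>i<n. cnj (w (p div k, p mod k) i) * x i) = 0"
    define F where "F l m = (cmod (\<Sum>i<n. cnj (w (l, m) i) * x i))\<^sup>2" for l m
    have F0: "0 \<le> F l m" for l m by (simp add: F_def)
    have Fz: "F l m = 0" if "l < s" "m < k" for l m
    proof -
      have "l * k + m < Suc l * k" using that by simp
      also have "\<dots> \<le> s * k" using that by (intro mult_right_mono) auto
      finally show ?thesis using x[of "l * k + m"] that by (simp add: F_def)
    qed
    \<comment> \<open>For fixed \<open>m\<close>, this is Parseval for \<open>u\<close> applied to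
      \<open>x\<close> multiplied entrywise by the conjugate of \<open>v m\<close>.\<close>
    have sumF: "(\<Sum>l<n. F l m) = (\<Sum>i<n. (cmod (v m i))\<^sup>2 * (cmod (x i))\<^sup>2)" for m
      using parseval[OF u, of "\<lambda>i. cnj (v m i) * x i"]
      by (simp add: F_def w_def mult.assoc norm_mult power_mult_distrib)
    have sumF_le: "(\<Sum>l<n. F l m) \<le> (\<Sum>i<n. (cmod (x i))\<^sup>2)" if "m < n" for m
      unfolding sumF using orthonormal_basis_family_entry_le_1[OF v that]
      by (intro sum_mono mult_left_le_one_le) auto
    have sumFF: "(\<Sum>l<n. \<Sum>m<n. F l m) = (\<Sum>i<n. (cmod (x i))\<^sup>2)"
    proof -
      have "(\<Sum>l<n. \<Sum>m<n. F l m) = (\<Sum>m<n. \<Sum>i<n. (cmod (v m i))\<^sup>2 * (cmod (x i))\<^sup>2)"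
        by (subst sum.swap) (simp add: sumF)
      also have "\<dots> = (\<Sum>i<n. (\<Sum>m<n. (cmod (v m i))\<^sup>2) * (cmod (x i))\<^sup>2)"
        by (subst sum.swap) (simp add: sum_distrib_right)
      finally show ?thesis by (simp add: orthonormal_basis_family_sum_entries[OF v])
    qed
    have "Re (\<Sum>i<n. \<Sum>j<n. cnj (x i) * hadamard A B $$ (i, j) * x j) =
        (\<Sum>p\<in>{..<n} \<times> {..<n}. \<sigma> (fst p) * \<mu> (snd p) * (cmod (\<Sum>i<n. cnj (w p i) * x i))\<^sup>2)"
      by (subst quadratic_form_sum_rank_one[OF H]) auto
    also have "\<dots> = (\<Sum>l<n. \<Sum>m<n. \<sigma> l * \<mu> m * F l m)"
      unfolding sum.cartesian_product F_def by (intro sum.cong refl) auto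
    \<comment> \<open>The head term is kept for every pair, which only increases the bound and lets
      the full double sum of \<open>F\<close> be evaluated by \<open>sumFF\<close>.\<close>
    also have "\<dots> \<le> (\<Sum>l<n. \<Sum>m<n. \<sigma> s * \<mu> 0 * F l m + (if k \<le> m then \<sigma> 0 * \<mu> m * F l m else 0))"
    proof (intro sum_mono)
      fix l m assume "l \<in> {..<n}" "m \<in> {..<n}"
      then have lm: "l < n" "m < n" by auto
      have nn: "0 \<le> \<sigma> s * \<mu> 0 * F l m" using \<sigma>0[OF s] \<mu>0[OF n0] F0 by simp
      consider "k \<le> m" | "m < k" "l < s" | "m < k" "s \<le> l" by linarith
      then show "\<sigma> l * \<mu> m * F l m \<le> \<sigma> s * \<mu> 0 * F l m + (if k \<le> m then \<sigma> 0 * \<mu> m * F l m else 0)"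
      proof cases
        case 1
        have "\<sigma> l * \<mu> m * F l m \<le> \<sigma> 0 * \<mu> m * F l m"
          using lm F0 \<mu>0 \<sigma>_anti by (intro mult_right_mono) auto
        then show ?thesis using 1 nn by simp
      next
        case 2
        then show ?thesis by (simp add: Fz)
      next
        case 3
        have "\<sigma> l * \<mu> m * F l m \<le> \<sigma> s * \<mu> 0 * F l m"
          using lm F0 \<mu>0 \<sigma>0 \<sigma>_anti \<mu>_anti 3 s n0 by (intro mult_right_mono mult_mono) auto
        then show ?thesis using 3 by simp
      qed
    qed
    also have "\<dots> = \<sigma> s * \<mu> 0 * (\<Sum>l<n. \<Sum>m<n. F l m) +
        (\<Sum>l<n. \<Sum>m<n. if k \<le> m then \<sigma> 0 * \<mu> m * F l m else 0)"
      by (simp add: sum.distrib sum_distrib_left)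
    also have "(\<Sum>l<n. \<Sum>m<n. if k \<le> m then \<sigma> 0 * \<mu> m * F l m else 0) =
        (\<Sum>m<n. if k \<le> m then \<sigma> 0 * \<mu> m * (\<Sum>l<n. F l m) else 0)"
      by (subst sum.swap) (auto simp: sum_distrib_left intro!: sum.cong)
    also have "\<dots> = (\<Sum>m\<in>{k..<n}. \<sigma> 0 * \<mu> m * (\<Sum>l<n. F l m))"
      by (rule sum.mono_neutral_cong_right) auto
    \<comment> \<open>Bounding the sum over \<open>l\<close> separately for each \<open>m\<close>
      leaves the plain tail sum of the eigenvalues of \<open>B\<close>, with no extra factor of the
      dimension.\<close>
    also have "\<dots> \<le> (\<Sum>m\<in>{k..<n}. \<sigma> 0 * \<mu> m * (\<Sum>i<n. (cmod (x i))\<^sup>2))"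
      using \<sigma>0 \<mu>0 n0 by (intro sum_mono mult_left_mono sumF_le) auto
    also have "\<sigma> s * \<mu> 0 * (\<Sum>l<n. \<Sum>m<n. F l m) +
        (\<Sum>m\<in>{k..<n}. \<sigma> 0 * \<mu> m * (\<Sum>i<n. (cmod (x i))\<^sup>2)) =
        (\<sigma> s * \<mu> 0 + \<sigma> 0 * (\<Sum>m\<in>{k..<n}. \<mu> m)) * (\<Sum>i<n. (cmod (x i))\<^sup>2)"
      unfolding sumFF
      by (simp add: distrib_right sum_distrib_left[symmetric] sum_distrib_right[symmetric])
    finally show "Re (\<Sum>i<n. \<Sum>j<n. cnj (x i) * hadamard A B $$ (i, j) * x j) \<le>
        (\<sigma> s * \<mu> 0 + \<sigma> 0 * (\<Sum>m\<in>{k..<n}. \<mu> m)) * (\<Sum>i<n. (cmod (x i))\<^sup>2)" by simp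
  qed
  \<comment> \<open>Passes from the zero-based \<open>\<mu>\<close> to the one-based
    \<open>eig_lambda\<close>.\<close>
  moreover have "(\<Sum>m\<in>{k..<n}. \<mu> m) = ?t"
    unfolding \<mu>_def by (rule sum.reindex_bij_witness[of _ "\<lambda>j. j - 1" Suc]) auto
  ultimately show ?thesis by (simp add: \<sigma>_def \<mu>_def)
qed

section \<open>Exponential decay\<close>

theorem mainTheorem9:
  fixes C \<alpha> C' c' :: real
  assumes "C > 0" and "\<alpha> > 0" and "C' > 0" and "c' > 0"
  shows "\<exists>K \<alpha>'. K > 0 \<and> \<alpha>' > 0 \<and>
    (\<forall>(W::nat) (kstar::nat) (A::complex mat) (B::complex mat).
       1 \<le> W \<and> 1 \<le> kstar \<and> kstar \<le> W \<and>
       A \<in> carrier_mat W W \<and> B \<in> carrier_mat W W \<and>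
       psd_mat A \<and> psd_mat B \<and>
       (\<forall>j. 1 \<le> j \<and> j \<le> W \<longrightarrow> eig_lambda j A \<le> C * exp (- \<alpha> * real j)) \<and>
       (\<forall>j. 1 \<le> j \<and> j \<le> kstar \<longrightarrow> eig_lambda j B \<le> C') \<and>
       (\<Sum>j\<in>{kstar<..W}. eig_lambda j B) \<le> exp (- c' * real W)
       \<longrightarrow>
       (\<forall>s::nat. 1 \<le> s \<and> s * kstar + 1 \<le> W \<longrightarrow>
          eig_lambda (s * kstar + 1) (hadamard A B) \<le> K * exp (- \<alpha>' * real s)) \<and>
       (\<forall>k::nat. kstar \<le> k \<and> k \<le> W \<longrightarrow>
          eig_lambda k (hadamard A B) \<le> K * exp (- \<alpha>' * real (k div kstar))))"
proof -
  \<comment> \<open>The smaller rate serves both summands: the first decays through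
    \<open>A\<close>, and the second is at most \<open>C * exp (- c' * real W)\<close>, where
    \<open>s < W\<close>. Their coefficients \<open>C * C'\<close> and \<open>C\<close> add up to
    \<open>K\<close>.\<close>
  define \<beta> where "\<beta> = min \<alpha> c'"
  define K where "K = C * C' + C"
  have \<beta>: "0 < \<beta>" "\<beta> \<le> \<alpha>" "\<beta> \<le> c'" using assms by (auto simp: \<beta>_def)
  have K: "0 < K" using assms by (simp add: K_def add_pos_pos)
  have "(\<forall>s. 1 \<le> s \<and> s * k + 1 \<le> W \<longrightarrow>
          eig_lambda (s * k + 1) (hadamard A B) \<le> K * exp \<beta> * exp (- \<beta> * real s)) \<and>
       (\<forall>j. k \<le> j \<and> j \<le> W \<longrightarrow>
          eig_lambda j (hadamard A B) \<le> K * exp \<beta> * exp (- \<beta> * real (j div k)))"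
    if W: "1 \<le> W" and k: "1 \<le> k" "k \<le> W"
      and A: "A \<in> carrier_mat W W" "psd_mat A" and B: "B \<in> carrier_mat W W" "psd_mat B"
      and lamA: "\<forall>j. 1 \<le> j \<and> j \<le> W \<longrightarrow> eig_lambda j A \<le> C * exp (- \<alpha> * real j)"
      and lamB: "\<forall>j. 1 \<le> j \<and> j \<le> k \<longrightarrow> eig_lambda j B \<le> C'"
      and tail: "(\<Sum>j\<in>{k<..W}. eig_lambda j B) \<le> exp (- c' * real W)"
    for W k A B
  proof -
    \<comment> \<open>Here \<open>s = 0\<close> is allowed; the second conclusion needs it at the
      index \<open>k\<close>.\<close>
    have main: "eig_lambda (Suc (s * k)) (hadamard A B) \<le> K * exp (- \<beta> * real s)"
      if sk: "s * k < W" for s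
    proof -
      have "s \<le> s * k" using k by simp
      then have s: "s < W" using sk by linarith
      have "eig_lambda (s + 1) A \<le> C * exp (- \<alpha> * real (s + 1))"
        using lamA[rule_format, of "s + 1"] s by simp
      also have "\<dots> \<le> C * exp (- \<beta> * real s)"
      proof -
        have "\<beta> * real s \<le> \<alpha> * real (s + 1)" using \<beta> by (intro mult_mono) auto
        then show ?thesis using assms by simp
      qed
      finally have 1: "eig_lambda (s + 1) A \<le> C * exp (- \<beta> * real s)" .
      have 2: "eig_lambda 1 B \<le> C'" "0 \<le> eig_lambda 1 B"
        using lamB k psd_mat_eig_lambda_nonneg[OF B, of 0] W by auto
      have "eig_lambda 1 A \<le> C * exp (- \<alpha> * real 1)" using lamA W by blast
      also have "\<dots> \<le> C" using assms by simp
      finally have 3: "eig_lambda 1 A \<le> C" .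
      have "\<beta> * real s \<le> c' * real W" using \<beta> s by (intro mult_mono) auto
      then have 4: "(\<Sum>j\<in>{k<..W}. eig_lambda j B) \<le> exp (- \<beta> * real s)"
        using tail by (smt (verit) exp_le_cancel_iff mult_minus_left)
      have 5: "0 \<le> (\<Sum>j\<in>{k<..W}. eig_lambda j B)"
      proof (rule sum_nonneg)
        fix j assume "j \<in> {k<..W}"
        then show "0 \<le> eig_lambda j B" using psd_mat_eig_lambda_nonneg[OF B, of "j - 1"] by auto
      qed
      have "eig_lambda (Suc (s * k)) (hadamard A B) \<le>
          eig_lambda (s + 1) A * eig_lambda 1 B + eig_lambda 1 A * (\<Sum>j\<in>{k<..W}. eig_lambda j B)"
        using eig_lambda_hadamard_le[OF A B k(1) sk] by simp
      also have "\<dots> \<le> C * exp (- \<beta> * real s) * C' + C * exp (- \<beta> * real s)"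
        using 1 2 3 4 5 assms by (intro add_mono mult_mono) auto
      finally show ?thesis by (simp add: K_def algebra_simps)
    qed
    show ?thesis
    proof (intro conjI allI impI)
      fix s assume "1 \<le> s \<and> s * k + 1 \<le> W"
      then have "eig_lambda (s * k + 1) (hadamard A B) \<le> K * exp (- \<beta> * real s)"
        using main[of s] by simp
      also have "\<dots> \<le> K * exp \<beta> * exp (- \<beta> * real s)" using K \<beta> by simp
      finally show "eig_lambda (s * k + 1) (hadamard A B) \<le> K * exp \<beta> * exp (- \<beta> * real s)" .
    next
      fix j assume j: "k \<le> j \<and> j \<le> W"
      \<comment> \<open>The largest \<open>s\<close> with \<open>s * k + 1 \<le> j\<close>, so
        monotonicity of the eigenvalues applies. It can fall short of \<open>j div k\<close> by one,
        and the factor \<open>exp \<beta>\<close> in the final constant absorbs this.\<close>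
      define s where "s = (j - 1) div k"
      have sk: "s * k \<le> j - 1" unfolding s_def by (rule div_times_less_eq_dividend)
      have "j div k \<le> Suc s"
      proof -
        have "j div k \<le> (j - 1 + k) div k" using k by (intro div_le_mono) simp
        also have "\<dots> = Suc s" using k by (simp add: s_def)
        finally show ?thesis .
      qed
      then have js: "real (j div k) \<le> real s + 1" by linarith
      have "eig_lambda (Suc (j - 1)) (hadamard A B) \<le> eig_lambda (Suc (s * k)) (hadamard A B)"
        using j k W by (intro eig_lambda_antimono[OF hadamard_carrier[OF A(1)] sk]) auto
      also have "\<dots> \<le> K * exp (- \<beta> * real s)" using sk j k by (intro main) linarith
      also have "\<dots> \<le> K * (exp \<beta> * exp (- \<beta> * real (j div k)))"
        using K \<beta> mult_left_mono[OF js, of \<beta>]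
        by (simp add: exp_add[symmetric] algebra_simps)
      finally show "eig_lambda j (hadamard A B) \<le> K * exp \<beta> * exp (- \<beta> * real (j div k))"
        using j k by (simp add: mult.assoc)
    qed
  qed
  note bound = this
  show ?thesis
  proof (rule exI[of _ "K * exp \<beta>"], rule exI[of _ \<beta>], rule conjI[OF _ conjI])
    show "0 < K * exp \<beta>" "0 < \<beta>" using K \<beta>(1) by simp_all
  qed (intro allI impI, elim conjE, rule bound)
qed

end
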